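(* Let $n$ and $k$ be positive integers with $k\leq n$, let $0\leq m\leq n-1$, and let $e_{k,n,m}$ be the coefficient of $t^m$ in the Ehrhart polynomial $E_{k,n}(t)$ of the hypersimplex $\Delta_{k,n}$. Then $$e_{k,n,m} = \frac{1}{(n-1)!}\sum_{\ell=0}^{k-1} W(\ell,n,m+1)\, A(m,k-\ell-1),$$ where $W(\ell,n,m+1)$ are weighted Lah numbers and $A(m,k-\ell-1)$ are Eulerian numbers. In particular, $e_{k,n,m}$ is positive.
   Context: Hypersimplex: for positive integers $k\leq n$, $\Delta_{k,n} := \{x\in [0,1]^n : \sum_{i=1}^n x_i = k\}\subset\mathbb{R}^n$. Its Ehrhart polynomial is the unique $E_{k,n}\in\mathbb{Q}[t]$ with $E_{k,n}(t)=|\mathbb{Z}^n\cap t\Delta_{k,n}|$ for all integers $t\geq 0$. Weighted Lah numbers: a partition $\pi$ of $\{1,\ldots,n\}$ into $m$ linearly ordered blocks is a set partition of $\{1,\ldots,n\}$ into exactly $m$ nonempty blocks, each equipped with a linear order (the collection of blocks itself being unordered). For a linearly ordered block $b$, its weight $w(b)$ is the number of elements of $b$ that are smaller (as positive integers) than the first element of $b$ in its linear order. The weight of $\pi$ is $w(\pi):=\sum_{b\in\pi}w(b)$. The weighted Lah number $W(\ell,n,m)$ is the number of partitions of $\{1,\ldots,n\}$ into exactly $m$ linearly ordered blocks having weight $\ell$. Eulerian numbers: $A(m,j)$ is the number of permutations of $m$ elements with exactly $j$ descents; in particular $A(0,0)=1$, $A(0,j)=0$ for $j\geq 1$, and $A(m,j)=0$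 for $j\geq m\geq 1$.
   Formalization: Positivity is claimed only when k < n or m = 0: for k = n and m ≥ 1 the hypersimplex is a single point, its Ehrhart polynomial is 1, and e_{n,n,m} = 0. The formula is stated for the full range. *)

theory Defs
  imports
    "HOL-Analysis.Analysis"
    "HOL-Combinatorics.Permutations"
    "HOL-Computational_Algebra.Polynomial"
    "HOL-Library.Disjoint_Sets"
begin

definition hypersimplex :: "nat \<Rightarrow> (real ^ 'n) set" where
  "hypersimplex k = {x. (\<forall>i. x $ i \<in> {0..1}) \<and> (\<Sum>i\<in>UNIV. x $ i) = real k}"

definition lattice_points :: "(real ^ 'n) set \<Rightarrow> (real ^ 'n) set" where
  "lattice_points S = {x \<in> S. \<forall>i. x $ i \<in> \<int>}"

(* Meaningful only for bounded S whose lattice point count is polynomial in the dilation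
   factor; the condition includes t = 0. *)
definition ehrhart_poly :: "(real ^ 'n) set \<Rightarrow> rat poly" where
  "ehrhart_poly S =
     (THE p. \<forall>t::nat. poly p (of_nat t) =
        of_nat (card (lattice_points ((\<lambda>x. real t *\<^sub>R x) ` S))))"

(* A linearly ordered block is encoded as the distinct list of its elements in increasing
   position; injectivity of set on B says that each block carries only one order. *)
definition ordered_block_partition :: "nat \<Rightarrow> nat list set \<Rightarrow> bool" where
  "ordered_block_partition n B \<longleftrightarrow>
     (\<forall>b\<in>B. distinct b) \<and> inj_on set B \<and> partition_on {1..n} (set ` B)"

definition block_weight :: "nat list \<Rightarrow> nat" where
  "block_weight b = card {x \<in> set b. x < hd b}"

definition weighted_lah :: "nat \<Rightarrow> nat \<Rightarrow> nat \<Rightarrow> nat" where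
  "weighted_lah l n m =
     card {B. ordered_block_partition n B \<and> card B = m \<and> (\<Sum>b\<in>B. block_weight b) = l}"

definition descents :: "nat \<Rightarrow> (nat \<Rightarrow> nat) \<Rightarrow> nat set" where
  "descents m p = {i. 1 \<le> i \<and> i < m \<and> p i > p (Suc i)}"

definition eulerian :: "nat \<Rightarrow> nat \<Rightarrow> nat" where
  "eulerian m j = card {p. p permutes {1..m} \<and> card (descents m p) = j}"

end

theory Submission
  imports
    Defs
    "HOL-Computational_Algebra.Polynomial_FPS"
    "HOL-Combinatorics.Multiset_Permutations"
begin

text \<open>
  The proof compares two generating functions in which the same polynomials occur.

  Lattice points of the dilated hypersimplex are the vectors with entries in $\{0,\dots,t\}$ and sum
  $kt$, so their number is the coefficient of $X^{kt}$ in $((1 - X^{t+1})/(1 - X))^n$. Expanding the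
  numerator gives (\<open>card_bounded_functions_eq\<close>)
  \[ (n-1)!\,E_{k,n}(t) = \sum_{j<k} (-1)^j \binom{n}{j} Q_j((k-j)t), \qquad
     Q_j(y) = (y + 1 - j)(y + 2 - j) \cdots (y + n - 1 - j), \]
  and the coefficient of $t^m$ is $\sum_{j<k} c_j (k-j)^m$, where $c_j$ is $(-1)^j \binom{n}{j}$ times
  the coefficient of $y^m$ in $Q_j$. This is a convolution, namely the coefficient of $X^{k-1}$ in
  $(\sum_j c_j X^j)(\sum_i (i+1)^m X^i)$.

  The polynomials $Q_j$ also describe ordered partitions. By the exponential formula, marking
  each block by $(1-x)y$ and the weight by $x$ turns the exponential generating function of ordered
  partitions into $((1 - xz)/(1 - z))^y$ (\<open>sum_ordered_partitions\<close>), and the coefficient of $z^n/n!$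
  there is $y \sum_j \binom{n}{j} (-x)^j Q_j(y)$ (\<open>lah_fps_nth\<close>). Comparing the coefficients of
  $y^{m+1}$ yields (\<open>lah_fps_identity\<close>)
  \[ \sum_j c_j X^j = (1 - X)^{m+1} \sum_l W(l, n, m+1) X^l. \]

  Finally $(1 - X)^{m+1} \sum_i (i+1)^m X^i = \sum_j A(m,j) X^j$ (\<open>carlitz_identity\<close>), so the
  alternating signs disappear and the product above is the product of the generating functions of
  weighted Lah numbers and of Eulerian numbers. All terms are nonnegative, and if $k < n$ or $m = 0$
  then a positive one exists by \<open>weighted_lah_pos\<close> and \<open>eulerian_pos\<close>.
\<close>

unbundle no vec_syntax
unbundle fps_syntax

section \<open>The power series of weighted ordered partitions\<close>

text \<open>
  This is the power series of $(1 - cX)^{-a}$. The exponent $a$ is a ring element rather than a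
  number, so that a coefficient can be read as a polynomial in $a$.
\<close>

definition neg_binomial_fps :: "'a::field_char_0 \<Rightarrow> 'a \<Rightarrow> 'a fps" where
  "neg_binomial_fps c a = Abs_fps (\<lambda>n. pochhammer a n * c ^ n / fact n)"

text \<open>
  The first-order differential equation of $(1 - cX)^{-a}$. It turns every manipulation of the series
  into ring arithmetic and avoids logarithms and compositions of power series.
\<close>

lemma neg_binomial_fps_deriv:
  "(1 - fps_const c * fps_X) * fps_deriv (neg_binomial_fps c a)
     = fps_const (a * c) * neg_binomial_fps c a"
proof (rule fps_ext)
  fix n
  have *: "(1 - fps_const c * fps_X) * F = F - fps_const c * (fps_X * F)" for F :: "'a fps"
    by (simp add: algebra_simps)
  show "((1 - fps_const c * fps_X) * fps_deriv (neg_binomial_fps c a)) $ n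
     = (fps_const (a * c) * neg_binomial_fps c a) $ n"
    unfolding *
    by (cases n) (simp_all add: neg_binomial_fps_def pochhammer_Suc divide_simps del: of_nat_Suc,
        simp_all add: algebra_simps)
qed

lemma fps_geometric: "(1 - fps_const c * fps_X) * Abs_fps (\<lambda>n. c ^ n) = (1 :: 'a::comm_ring_1 fps)"
proof (rule fps_ext)
  fix n
  have *: "(1 - fps_const c * fps_X) * F = F - fps_const c * (fps_X * F)" for F :: "'a fps"
    by (simp add: algebra_simps)
  show "((1 - fps_const c * fps_X) * Abs_fps (\<lambda>n. c ^ n)) $ n = (1 :: 'a fps) $ n"
    unfolding * by (cases n) simp_all
qed

text \<open>
  This is $((1 - xX)/(1 - X))^y$. Weighted ordered partitions form the exponential of the series of a
  single block, $\sum_b (1 + x + \dots + x^{b-1}) X^b/b = \frac{1}{1-x}\log\frac{1 - xX}{1 - X}$;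
  marking each block by $(1-x)y$ cancels the denominator $1 - x$ and leaves this power.
\<close>

definition lah_fps :: "'a::field_char_0 \<Rightarrow> 'a \<Rightarrow> 'a fps" where
  "lah_fps x y = neg_binomial_fps 1 y * neg_binomial_fps x (- y)"

text \<open>
  The logarithmic derivative of $((1 - xX)/(1 - X))^y$ is $(1-x)y / ((1 - X)(1 - xX))$, and the
  coefficients of $1/((1 - X)(1 - xX))$ are the sums $1 + x + \dots + x^b$. The result has the shape
  of the recursion that removes from a partition the block containing a given element.
\<close>

lemma lah_fps_rec:
  "of_nat (Suc n) * lah_fps x y $ Suc n
     = (1 - x) * y * (\<Sum>b\<le>n. (\<Sum>i\<le>b. x ^ i) * lah_fps x y $ (n - b))"
proof -
  let ?P = "neg_binomial_fps 1 y" and ?Q = "neg_binomial_fps x (- y)"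
  let ?a = "1 - fps_X :: 'a fps" and ?b = "1 - fps_const x * fps_X"
  let ?G = "Abs_fps (\<lambda>n. 1 ^ n)" and ?H = "Abs_fps (\<lambda>n. x ^ n)"
  have P: "?a * fps_deriv ?P = fps_const y * ?P"
    using neg_binomial_fps_deriv[of 1 y] by simp
  have Q: "?b * fps_deriv ?Q = - (fps_const y * fps_const x) * ?Q"
    using neg_binomial_fps_deriv[of x "- y"] by (simp flip: fps_const_neg)
  have "?a * ?b * fps_deriv (lah_fps x y) = ?b * ?Q * (?a * fps_deriv ?P) + ?a * ?P * (?b * fps_deriv ?Q)"
    by (simp add: lah_fps_def algebra_simps)
  also have "\<dots> = (?b * fps_const y - ?a * (fps_const y * fps_const x)) * lah_fps x y"
    unfolding P Q by (simp add: lah_fps_def algebra_simps del: fps_const_mult)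
  also have "?b * fps_const y - ?a * (fps_const y * fps_const x) = fps_const ((1 - x) * y)"
    by (simp add: algebra_simps flip: fps_const_mult fps_const_sub)
  finally have ode: "?a * ?b * fps_deriv (lah_fps x y) = fps_const ((1 - x) * y) * lah_fps x y" .
  have 1: "?a * ?G = 1" "?b * ?H = 1"
    using fps_geometric[of "1::'a"] fps_geometric[of x] by simp_all
  have "fps_deriv (lah_fps x y) = (?a * ?G) * (?b * ?H) * fps_deriv (lah_fps x y)"
    unfolding 1 by simp
  also have "\<dots> = ?G * ?H * (?a * ?b * fps_deriv (lah_fps x y))"
    by (simp add: mult_ac)
  also have "\<dots> = fps_const ((1 - x) * y) * ((?G * ?H) * lah_fps x y)"
    unfolding ode by (simp add: mult_ac)
  finally have "fps_deriv (lah_fps x y) $ n = \<dots> $ n" by simp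
  moreover
  have "(?G * ?H) $ b = (\<Sum>i\<le>b. x ^ i)" for b
  proof -
    have "(\<Sum>i\<le>b. x ^ (b - i)) = (\<Sum>i\<le>b. x ^ i)"
      by (rule sum.reindex_bij_witness[of _ "\<lambda>i. b - i" "\<lambda>i. b - i"]) auto
    then show ?thesis by (simp add: fps_mult_nth atLeast0AtMost)
  qed
  then have "((?G * ?H) * lah_fps x y) $ n = (\<Sum>b\<le>n. (\<Sum>i\<le>b. x ^ i) * lah_fps x y $ (n - b))"
    unfolding fps_mult_nth[of "?G * ?H"] by (simp only: atLeast0AtMost)
  ultimately show ?thesis by simp
qed

section \<open>Counting ordered partitions by removing a block\<close>

text \<open>
  Partitions of an arbitrary finite set are needed, since removing a block from a partition of
  $\{1,\dots,n\}$ leaves a partition of a set that is not an initial segment.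
\<close>

definition ordered_partitions :: "nat set \<Rightarrow> nat list set set" where
  "ordered_partitions S = {B. (\<forall>b\<in>B. distinct b) \<and> inj_on set B \<and> partition_on S (set ` B)}"

text \<open>
  Two different orders of the same block would have the same nonempty element set, so pairwise
  disjointness of the lists themselves encodes both the partition and the uniqueness of the orders.
\<close>

lemma ordered_partitions_iff:
  "B \<in> ordered_partitions S \<longleftrightarrow> (\<forall>b\<in>B. distinct b \<and> b \<noteq> []) \<and> (\<Union>b\<in>B. set b) = S \<and>
     (\<forall>b\<in>B. \<forall>b'\<in>B. b \<noteq> b' \<longrightarrow> set b \<inter> set b' = {})"
proof -
  let ?D = "\<forall>b\<in>B. \<forall>b'\<in>B. b \<noteq> b' \<longrightarrow> set b \<inter> set b' = {}"
  have 1: "inj_on set B" if "\<forall>b\<in>B. b \<noteq> []" ?D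
    using that by (metis inj_onI inf.idem set_empty)
  have 2: "disjoint (set ` B) \<longleftrightarrow> ?D" if "inj_on set B"
    using that unfolding disjoint_def by (simp add: inj_on_eq_iff)
  have 3: "{} \<notin> set ` B \<longleftrightarrow> (\<forall>b\<in>B. b \<noteq> [])" by auto
  have "B \<in> ordered_partitions S \<longleftrightarrow>
      (\<forall>b\<in>B. distinct b) \<and> inj_on set B \<and> \<Union> (set ` B) = S \<and> disjoint (set ` B) \<and> (\<forall>b\<in>B. b \<noteq> [])"
    unfolding ordered_partitions_def partition_on_def 3 mem_Collect_eq ..
  also have "\<dots> \<longleftrightarrow> (\<forall>b\<in>B. distinct b) \<and> (\<forall>b\<in>B. b \<noteq> []) \<and> \<Union> (set ` B) = S \<and> ?D"
    using 1 2 by argo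
  also have "\<dots> \<longleftrightarrow> (\<forall>b\<in>B. distinct b \<and> b \<noteq> []) \<and> \<Union> (set ` B) = S \<and> ?D"
    by (simp only: ball_conj_distrib conj_assoc)
  finally show ?thesis .
qed

lemma ordered_partitions_atLeastAtMost:
  "B \<in> ordered_partitions {1..n} \<longleftrightarrow> ordered_block_partition n B"
  by (simp add: ordered_partitions_def ordered_block_partition_def)

lemma ordered_partitions_empty: "ordered_partitions {} = {{}}"
  by (auto simp: ordered_partitions_iff)

lemma finite_ordered_partitions:
  assumes "finite S"
  shows "finite (ordered_partitions S)"
proof (rule finite_subset)
  show "ordered_partitions S \<subseteq> Pow {b. set b \<subseteq> S \<and> distinct b}"
    by (auto simp: ordered_partitions_iff)
  show "finite (Pow {b. set b \<subseteq> S \<and> distinct b})"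
    using finite_subset_distinct[OF assms] by simp
qed

lemma finite_ordered_partition: "finite S \<Longrightarrow> B \<in> ordered_partitions S \<Longrightarrow> finite B"
  by (rule finite_subset[OF _ finite_subset_distinct[of S]]) (auto simp: ordered_partitions_iff)

text \<open>
  Every element $s$ lies in exactly one block, and removing it leaves an arbitrary ordered
  partition of the remaining elements.
\<close>

lemma bij_betw_insert_block:
  assumes "s \<in> S"
  shows "bij_betw (\<lambda>(b, B). insert b B)
     (SIGMA b:{b. distinct b \<and> s \<in> set b \<and> set b \<subseteq> S}. ordered_partitions (S - set b))
     (ordered_partitions S)"
  unfolding bij_betw_def
proof
  let ?D = "SIGMA b:{b. distinct b \<and> s \<in> set b \<and> set b \<subseteq> S}. ordered_partitions (S - set b)"
  show "inj_on (\<lambda>(b, B). insert b B) ?D"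
  proof (rule inj_onI)
    fix p q assume pq: "p \<in> ?D" "q \<in> ?D" "(case p of (b, B) \<Rightarrow> insert b B) = (case q of (b, B) \<Rightarrow> insert b B)"
    obtain b B c C where eq: "p = (b, B)" "q = (c, C)" by (metis prod.exhaust)
    have A: "(b, B) \<in> ?D" "(c, C) \<in> ?D" "insert b B = insert c C"
      using pq unfolding eq by simp_all
    have "s \<notin> (\<Union>d\<in>B. set d)" "s \<notin> (\<Union>d\<in>C. set d)" "s \<in> set b" "s \<in> set c"
      using A(1,2) by (auto simp: ordered_partitions_iff)
    then have "b \<notin> B" "b \<notin> C" "c \<notin> C" by auto
    with A(3) have "b = c \<and> B = C" by (metis insert_iff insert_ident)
    then show "p = q" by (simp add: eq)
  qed
  show "(\<lambda>(b, B). insert b B) ` ?D = ordered_partitions S"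
  proof (intro equalityI subsetI)
    fix B assume "B \<in> (\<lambda>(b, B). insert b B) ` ?D"
    then obtain b C where *: "B = insert b C" "distinct b" "s \<in> set b" "set b \<subseteq> S"
      "C \<in> ordered_partitions (S - set b)" by auto
    have C: "\<forall>c\<in>C. distinct c \<and> c \<noteq> []" "(\<Union>c\<in>C. set c) = S - set b"
      "\<forall>c\<in>C. \<forall>c'\<in>C. c \<noteq> c' \<longrightarrow> set c \<inter> set c' = {}"
      using *(5) by (simp_all add: ordered_partitions_iff)
    have disj: "set b \<inter> set c = {}" if "c \<in> C" for c using C(2) that by blast
    show "B \<in> ordered_partitions S"
      unfolding ordered_partitions_iff
    proof (intro conjI ballI impI)
      show "(\<Union>c\<in>B. set c) = S" using *(1,4) C(2) by auto
      show "set c \<inter> set c' = {}" if "c \<in> B" "c' \<in> B" "c \<noteq> c'" for c c'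
        using that disj C(3) *(1) by (metis insert_iff inf_commute)
    qed (use *(1-3) C(1) in auto)
  next
    fix B assume B: "B \<in> ordered_partitions S"
    then obtain b where b: "b \<in> B" "s \<in> set b" using assms by (auto simp: ordered_partitions_iff)
    have C: "\<forall>c\<in>B. distinct c \<and> c \<noteq> []" "(\<Union>c\<in>B. set c) = S"
      "\<forall>c\<in>B. \<forall>c'\<in>B. c \<noteq> c' \<longrightarrow> set c \<inter> set c' = {}"
      using B by (simp_all add: ordered_partitions_iff)
    have "(\<Union>c\<in>B - {b}. set c) = S - set b"
    proof
      show "(\<Union>c\<in>B - {b}. set c) \<subseteq> S - set b"
      proof
        fix a assume "a \<in> (\<Union>c\<in>B - {b}. set c)"
        then obtain c where c: "c \<in> B" "c \<noteq> b" "a \<in> set c" by auto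
        then have "set c \<inter> set b = {}" using C(3) b(1) by simp
        then show "a \<in> S - set b" using c C(2) by auto
      qed
      show "S - set b \<subseteq> (\<Union>c\<in>B - {b}. set c)" using C(2) by auto
    qed
    then have "B - {b} \<in> ordered_partitions (S - set b)"
      unfolding ordered_partitions_iff using C(1,3) by simp
    then have "(b, B - {b}) \<in> ?D"
      using b C(1,2) by auto
    moreover have "B = insert b (B - {b})" using b by auto
    ultimately show "B \<in> (\<lambda>(b, B). insert b B) ` ?D"
      by (metis (no_types, lifting) case_prod_conv image_eqI)
  qed
qed

lemma sum_power_rank:
  fixes T :: "nat set" and x :: "'a::comm_semiring_1"
  assumes "finite T"
  shows "(\<Sum>a\<in>T. x ^ card {c\<in>T. c < a}) = (\<Sum>i<card T. x ^ i)"
  using assms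
proof (induction rule: finite_linorder_max_induct)
  case (insert a T)
  have a: "a \<notin> T" using insert.hyps(2) by auto
  have "{c \<in> insert a T. c < a} = T" using insert.hyps(2) by auto
  moreover have "{c \<in> insert a T. c < d} = {c\<in>T. c < d}" if "d \<in> T" for d
    using insert.hyps(2) that by (auto dest: order.asym)
  ultimately have "(\<Sum>d\<in>insert a T. x ^ card {c\<in>insert a T. c < d})
      = x ^ card T + (\<Sum>d\<in>T. x ^ card {c\<in>T. c < d})"
    using a insert.hyps(1) by (simp cong: sum.cong)
  then show ?case
    using a insert.hyps(1) insert.IH by (simp add: add.commute)
qed simp

text \<open>
  The weight of a block depends only on its first element, of which the elements of $T$ realise
  the weights $0, \dots, |T| - 1$ once each; the other elements can be arranged freely.
\<close>

lemma sum_block_weight: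
  fixes x :: "'a::field_char_0"
  assumes "finite T" "T \<noteq> {}"
  shows "(\<Sum>b\<in>permutations_of_set T. x ^ block_weight b)
       = fact (card T - 1) * (\<Sum>i<card T. x ^ i)"
proof -
  have "(\<Sum>b\<in>permutations_of_set T. x ^ block_weight b)
      = (\<Sum>a\<in>T. \<Sum>b\<in>(#) a ` permutations_of_set (T - {a}). x ^ block_weight b)"
    unfolding permutations_of_set_nonempty[OF assms(2)] using assms(1)
    by (intro sum.UNION_disjoint) auto
  also have "\<dots> = (\<Sum>a\<in>T. fact (card T - 1) * x ^ card {c\<in>T. c < a})"
  proof (rule sum.cong)
    fix a assume a: "a \<in> T"
    have "block_weight (a # b) = card {c\<in>T. c < a}" if "b \<in> permutations_of_set (T - {a})" for b
    proof -
      have "set (a # b) = T" using that a by (auto simp: permutations_of_set_def)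
      then show ?thesis unfolding block_weight_def by simp
    qed
    then show "(\<Sum>b\<in>(#) a ` permutations_of_set (T - {a}). x ^ block_weight b)
         = fact (card T - 1) * x ^ card {c\<in>T. c < a}"
      using a assms(1) by (simp add: sum.reindex card_permutations_of_set)
  qed simp
  finally show ?thesis
    using sum_power_rank[OF assms(1), of x] by (simp flip: sum_distrib_left)
qed

lemma sum_Pow_card:
  fixes g :: "nat \<Rightarrow> 'a::comm_semiring_1"
  assumes "finite A"
  shows "(\<Sum>T\<in>Pow A. g (card T)) = (\<Sum>b\<le>card A. of_nat (card A choose b) * g b)"
proof -
  have "(\<Sum>T\<in>Pow A. g (card T)) = (\<Sum>b\<le>card A. \<Sum>T\<in>{T\<in>Pow A. card T = b}. g (card T))"
    using assms by (intro sum.group[symmetric]) (auto intro: card_mono)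
  also have "\<dots> = (\<Sum>b\<le>card A. of_nat (card A choose b) * g b)"
    using n_subsets[OF assms] by simp
  finally show ?thesis .
qed

text \<open>
  Fix $s \in S$ and remove its block. A block with $b$ further elements can be chosen in
  $\binom{n}{b}$ ways, where $n = |S| - 1$; its orders contribute $b!\,(1 + x + \dots + x^b)$ and the
  rest contributes, by induction, $(n-b)!$ times a coefficient of the series. The factorials combine
  to $n!$, and the remaining convolution is the recursion of the series.
\<close>

lemma sum_ordered_partitions:
  fixes x y :: "'a::field_char_0"
  assumes "finite S"
  shows "(\<Sum>B\<in>ordered_partitions S. ((1 - x) * y) ^ card B * x ^ (\<Sum>b\<in>B. block_weight b))
     = fact (card S) * lah_fps x y $ card S"
  using assms
proof (induction "card S" arbitrary: S rule: less_induct)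
  case less
  let ?q = "(1 - x) * y" and ?W = "\<lambda>B. \<Sum>b\<in>B. block_weight b"
  let ?Z = "\<lambda>S. \<Sum>B\<in>ordered_partitions S. ?q ^ card B * x ^ ?W B"
  show ?case
  proof (cases "S = {}")
    case True
    then show ?thesis
      by (simp add: ordered_partitions_empty lah_fps_def neg_binomial_fps_def)
  next
    case False
    then obtain s where s: "s \<in> S" by auto
    define n where "n = card (S - {s})"
    have n: "card S = Suc n" using s less.prems unfolding n_def by (metis card.remove)
    let ?L = "{b. distinct b \<and> s \<in> set b \<and> set b \<subseteq> S}"
    have finL: "finite ?L" by (rule finite_subset[OF _ finite_subset_distinct[OF less.prems]]) auto
    have "?Z S = (\<Sum>(b, B)\<in>(SIGMA b:?L. ordered_partitions (S - set b)).
        ?q ^ card (insert b B) * x ^ ?W (insert b B))"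
      using sum.reindex_bij_betw[OF bij_betw_insert_block[OF s],
        of "\<lambda>B. ?q ^ card B * x ^ ?W B"] by (simp add: case_prod_unfold)
    also have "\<dots> = (\<Sum>b\<in>?L. \<Sum>B\<in>ordered_partitions (S - set b).
        ?q ^ card (insert b B) * x ^ ?W (insert b B))"
      using finL less.prems by (intro sum.Sigma[symmetric]) (auto intro: finite_ordered_partitions)
    also have "\<dots> = (\<Sum>b\<in>?L. ?q * x ^ block_weight b * ?Z (S - set b))"
    proof (rule sum.cong)
      fix b assume b: "b \<in> ?L"
      have "?q ^ card (insert b B) * x ^ ?W (insert b B)
          = ?q * x ^ block_weight b * (?q ^ card B * x ^ ?W B)"
        if "B \<in> ordered_partitions (S - set b)" for B
      proof -
        have "b \<notin> B" "finite B"
          using that b less.prems finite_ordered_partition[of "S - set b" B]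
          by (auto simp: ordered_partitions_iff)
        then show ?thesis by (simp add: power_add mult_ac)
      qed
      then show "(\<Sum>B\<in>ordered_partitions (S - set b). ?q ^ card (insert b B) * x ^ ?W (insert b B))
          = ?q * x ^ block_weight b * ?Z (S - set b)"
        by (simp add: sum_distrib_left)
    qed simp
    also have "\<dots> = (\<Sum>T\<in>Pow (S - {s}). \<Sum>b | b \<in> ?L \<and> set b - {s} = T.
        ?q * x ^ block_weight b * ?Z (S - set b))"
      using finL less.prems by (intro sum.group[symmetric]) auto
    also have "\<dots> = (\<Sum>T\<in>Pow (S - {s}). ?q * (fact (card T) * (\<Sum>i\<le>card T. x ^ i)) *
        (fact (n - card T) * lah_fps x y $ (n - card T)))"
    proof (rule sum.cong)
      fix T assume "T \<in> Pow (S - {s})"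
      then have T: "T \<subseteq> S - {s}" "finite T" "s \<notin> T" using less.prems finite_subset by auto
      have eq: "{b. b \<in> ?L \<and> set b - {s} = T} = permutations_of_set (insert s T)"
        using T s by (auto simp: permutations_of_set_def)
      have c: "card (S - insert s T) = n - card T"
        using T less.prems unfolding n_def
        by (metis Diff_insert card_Diff_subset Diff_insert2)
      have "?Z (S - insert s T) = fact (n - card T) * lah_fps x y $ (n - card T)"
        using less.hyps[of "S - insert s T"] less.prems n unfolding c by simp
      moreover have "set b = insert s T" if "b \<in> permutations_of_set (insert s T)" for b
        using that by (auto simp: permutations_of_set_def)
      ultimately have "(\<Sum>b | b \<in> ?L \<and> set b - {s} = T. ?q * x ^ block_weight b * ?Z (S - set b))
         = (\<Sum>b\<in>permutations_of_set (insert s T). ?q * x ^ block_weight b *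
              (fact (n - card T) * lah_fps x y $ (n - card T)))"
        unfolding eq by simp
      also have "\<dots> = ?q * (\<Sum>b\<in>permutations_of_set (insert s T). x ^ block_weight b) *
              (fact (n - card T) * lah_fps x y $ (n - card T))"
        unfolding sum_distrib_left sum_distrib_right ..
      finally show "(\<Sum>b | b \<in> ?L \<and> set b - {s} = T. ?q * x ^ block_weight b * ?Z (S - set b))
         = ?q * (fact (card T) * (\<Sum>i\<le>card T. x ^ i)) *
            (fact (n - card T) * lah_fps x y $ (n - card T))"
        using sum_block_weight[of "insert s T" x] T by (simp add: lessThan_Suc_atMost)
    qed simp
    also have "\<dots> = (\<Sum>b\<le>n. of_nat (n choose b) * (?q * (fact b * (\<Sum>i\<le>b. x ^ i)) *
        (fact (n - b) * lah_fps x y $ (n - b))))"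
      unfolding n_def using less.prems by (intro sum_Pow_card) simp
    also have "\<dots> = (\<Sum>b\<le>n. fact n * (?q * ((\<Sum>i\<le>b. x ^ i) * lah_fps x y $ (n - b))))"
    proof (rule sum.cong)
      fix b assume "b \<in> {..n}"
      then have *: "of_nat (n choose b) * fact b * fact (n - b) = (fact n :: 'a)"
        by (simp add: binomial_fact)
      show "of_nat (n choose b) * (?q * (fact b * (\<Sum>i\<le>b. x ^ i)) * (fact (n - b) * lah_fps x y $ (n - b)))
         = fact n * (?q * ((\<Sum>i\<le>b. x ^ i) * lah_fps x y $ (n - b)))"
        unfolding *[symmetric] by (simp add: mult_ac)
    qed simp
    also have "\<dots> = fact n * (of_nat (Suc n) * lah_fps x y $ Suc n)"
      unfolding lah_fps_rec by (simp add: sum_distrib_left)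
    finally show ?thesis unfolding n by (simp add: mult_ac)
  qed
qed

section \<open>The weighted Lah numbers as an alternating sum\<close>

text \<open>
  This is the polynomial $(Y + 1 - j)(Y + 2 - j) \cdots (Y + n - 1 - j)$ in $Y$. It occurs twice: in
  the coefficients of $((1 - xX)/(1 - X))^y$ as a polynomial in $y$, and, divided by $(n-1)!$, in
  the lattice point count, evaluated at multiples of the dilation factor. This coincidence links the Ehrhart
  coefficients to the weighted Lah numbers.
\<close>

definition shifted_rising :: "nat \<Rightarrow> nat \<Rightarrow> 'a::field_char_0 poly" where
  "shifted_rising n j = pochhammer [:1 - of_nat j, 1:] (n - 1)"

lemma poly_pochhammer: "poly (pochhammer p n) y = pochhammer (poly p y) n"
  for y :: "'a::field_char_0"
  by (induction n) (simp_all add: pochhammer_Suc)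

lemma poly_shifted_rising: "poly (shifted_rising n j) y = pochhammer (y + 1 - of_nat j) (n - 1)"
  by (simp add: shifted_rising_def poly_pochhammer algebra_simps)

text \<open>
  Up to the sign $(-1)^j$ the factors on the left are $y - j + 1, \dots, y$ and $y, \dots, y + n - j - 1$:
  the $n - 1$ consecutive numbers from $y - j + 1$ to $y + n - j - 1$, and one more copy of $y$.
\<close>

lemma pochhammer_minus_mult_pochhammer:
  fixes y :: "'a::field_char_0"
  assumes "1 \<le> n" "j \<le> n"
  shows "pochhammer (- y) j * pochhammer y (n - j) = (- 1) ^ j * y * pochhammer (y + 1 - of_nat j) (n - 1)"
proof -
  have "pochhammer (y - of_nat j + 1) j * pochhammer y (n - j) = y * pochhammer (y - of_nat j + 1) (n - 1)"
  proof (cases "j = n")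
    case True
    then show ?thesis
      using assms(1) pochhammer_Suc[of "y - of_nat n + 1" "n - 1"] by (simp add: of_nat_diff mult.commute)
  next
    case False
    then have "n - j = Suc (n - 1 - j)" "n - 1 = j + (n - 1 - j)" using assms(2) by auto
    then show ?thesis
      using pochhammer_rec[of y "n - 1 - j"] pochhammer_product'[of "y - of_nat j + 1" j "n - 1 - j"]
      by (simp add: algebra_simps)
  qed
  then show ?thesis
    unfolding pochhammer_minus by (simp add: algebra_simps)
qed

lemma lah_fps_nth:
  fixes x y :: "'a::field_char_0"
  assumes "1 \<le> n"
  shows "fact n * lah_fps x y $ n
     = y * (\<Sum>j\<le>n. (- x) ^ j * of_nat (n choose j) * poly (shifted_rising n j) y)"
proof -
  have "lah_fps x y $ n = (neg_binomial_fps x (- y) * neg_binomial_fps 1 y) $ n"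
    by (simp add: lah_fps_def mult.commute)
  then have "fact n * lah_fps x y $ n = (\<Sum>j\<le>n. fact n * (pochhammer (- y) j * x ^ j / fact j
      * (pochhammer y (n - j) / fact (n - j))))"
    by (simp add: fps_mult_nth neg_binomial_fps_def sum_distrib_left atLeast0AtMost)
  also have "\<dots> = (\<Sum>j\<le>n. y * ((- x) ^ j * of_nat (n choose j) * poly (shifted_rising n j) y))"
  proof (rule sum.cong)
    fix j assume "j \<in> {..n}"
    then have j: "j \<le> n" by simp
    have "fact n * (pochhammer (- y) j * x ^ j / fact j * (pochhammer y (n - j) / fact (n - j)))
        = of_nat (n choose j) * x ^ j * (pochhammer (- y) j * pochhammer y (n - j))"
      using j by (simp add: binomial_fact)
    also have "\<dots> = y * ((- x) ^ j * of_nat (n choose j) * poly (shifted_rising n j) y)"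
      unfolding pochhammer_minus_mult_pochhammer[OF assms j] poly_shifted_rising
      by (simp add: power_minus[of x] mult_ac)
    finally show "fact n * (pochhammer (- y) j * x ^ j / fact j * (pochhammer y (n - j) / fact (n - j)))
        = y * ((- x) ^ j * of_nat (n choose j) * poly (shifted_rising n j) y)" .
  qed simp
  finally show ?thesis by (simp add: sum_distrib_left)
qed

definition lah_poly :: "nat \<Rightarrow> nat \<Rightarrow> 'a::field_char_0 poly" where
  "lah_poly n m = (\<Sum>B | B \<in> ordered_partitions {1..n} \<and> card B = m. monom 1 (\<Sum>b\<in>B. block_weight b))"

lemma coeff_lah_poly: "coeff (lah_poly n m :: 'a::field_char_0 poly) l = of_nat (weighted_lah l n m)"
proof -
  have "weighted_lah l n m = card {B \<in> {B. B \<in> ordered_partitions {1..n} \<and> card B = m}. (\<Sum>b\<in>B. block_weight b) = l}"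
    unfolding weighted_lah_def ordered_partitions_atLeastAtMost[symmetric] by (simp add: conj_ac)
  moreover have "coeff (lah_poly n m :: 'a poly) l
      = (\<Sum>B | B \<in> ordered_partitions {1..n} \<and> card B = m. if (\<Sum>b\<in>B. block_weight b) = l then 1 else 0)"
    by (simp add: lah_poly_def coeff_sum coeff_monom)
  moreover have "finite {B. B \<in> ordered_partitions {1..n} \<and> card B = m}"
    using finite_ordered_partitions[of "{1..n}"] by simp
  ultimately show ?thesis
    by (subst (asm) sum.inter_filter[symmetric]) simp_all
qed

text \<open>
  The generating function of ordered partitions and the explicit coefficient of the power series
  agree for all values of $x$ and $y$, so they agree as polynomials: first in $y$, where the coefficient
  of $y^{m+1}$ picks the partitions into $m + 1$ blocks, and then in $x$.
\<close>

lemma lah_poly_identity: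
  assumes "1 \<le> n"
  shows "[:1, - 1:] ^ Suc m * lah_poly n (Suc m)
     = (\<Sum>j\<le>n. monom ((- 1) ^ j * of_nat (n choose j) * coeff (shifted_rising n j) m) j :: 'a::field_char_0 poly)"
proof (rule poly_eq_poly_eq_iff[THEN iffD1, OF ext])
  fix x :: 'a
  let ?OP = "ordered_partitions {1..n}" and ?W = "\<lambda>B. \<Sum>b\<in>B. block_weight b"
  have fin: "finite ?OP" by (rule finite_ordered_partitions) simp
  have "(\<Sum>B\<in>?OP. monom ((1 - x) ^ card B * x ^ ?W B) (card B))
     = pCons 0 (\<Sum>j\<le>n. smult ((- x) ^ j * of_nat (n choose j)) (shifted_rising n j))" (is "?L = ?R")
  proof (rule poly_eq_poly_eq_iff[THEN iffD1, OF ext])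
    fix y
    have "poly ?L y = (\<Sum>B\<in>?OP. ((1 - x) * y) ^ card B * x ^ ?W B)"
      by (simp add: poly_sum poly_monom power_mult_distrib mult_ac)
    also have "\<dots> = fact n * lah_fps x y $ n"
      using sum_ordered_partitions[of "{1..n}" x y] by simp
    also have "\<dots> = poly ?R y"
      unfolding lah_fps_nth[OF assms] by (simp add: poly_sum)
    finally show "poly ?L y = poly ?R y" .
  qed
  then have "coeff ?L (Suc m) = coeff ?R (Suc m)" by simp
  moreover have "coeff ?L (Suc m) = poly ([:1, - 1:] ^ Suc m * lah_poly n (Suc m)) x"
  proof -
    have "coeff ?L (Suc m) = (\<Sum>B\<in>?OP. if card B = Suc m then (1 - x) ^ Suc m * x ^ ?W B else 0)"
      by (simp add: coeff_sum coeff_monom cong: if_cong)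
    also have "\<dots> = (\<Sum>B | B \<in> ?OP \<and> card B = Suc m. (1 - x) ^ Suc m * x ^ ?W B)"
      using fin by (simp only: sum.inter_filter)
    also have "\<dots> = poly ([:1, - 1:] ^ Suc m * lah_poly n (Suc m)) x"
      unfolding poly_mult poly_power by (simp add: lah_poly_def poly_sum poly_monom sum_distrib_left del: power_Suc)
    finally show ?thesis .
  qed
  ultimately show "poly ([:1, - 1:] ^ Suc m * lah_poly n (Suc m)) x
     = poly (\<Sum>j\<le>n. monom ((- 1) ^ j * of_nat (n choose j) * coeff (shifted_rising n j) m) j) x"
    by (simp add: coeff_sum poly_sum poly_monom power_minus[of x] mult_ac)
qed

lemma lah_fps_identity:
  assumes "1 \<le> n"
  shows "(1 - fps_X) ^ Suc m * Abs_fps (\<lambda>l. of_nat (weighted_lah l n (Suc m)))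
     = Abs_fps (\<lambda>j. (- 1) ^ j * of_nat (n choose j) * coeff (shifted_rising n j) m :: 'a::field_char_0)"
proof -
  have 1: "Abs_fps (\<lambda>l. of_nat (weighted_lah l n (Suc m))) = fps_of_poly (lah_poly n (Suc m) :: 'a poly)"
    by (simp add: fps_eq_iff coeff_lah_poly)
  have 2: "1 - fps_X = fps_of_poly [:1, - 1 :: 'a:]"
    by (simp add: fps_of_poly_pCons flip: fps_const_neg)
  have "coeff (\<Sum>j\<le>n. monom ((- 1) ^ j * of_nat (n choose j) * coeff (shifted_rising n j) m) j) i
     = ((- 1) ^ i * of_nat (n choose i) * coeff (shifted_rising n i) m :: 'a)" for i
    by (cases "i \<le> n") (simp_all add: coeff_sum coeff_monom binomial_eq_0)
  then show ?thesis
    unfolding 1 2 fps_of_poly_power[symmetric] fps_of_poly_mult[symmetric] lah_poly_identity[OF assms]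
    by (simp add: fps_eq_iff)
qed

text \<open>
  A witness: the singletons $1, \dots, m$ have weight $0$, and the block of all larger elements
  has weight $l$ when it starts with its element number $l + 1$ in increasing order.
\<close>

lemma weighted_lah_pos:
  assumes "l + m < n"
  shows "0 < weighted_lah l n (Suc m)"
proof -
  define c where "c = Suc m + l"
  define b where "b = c # sorted_list_of_set ({Suc m..n} - {c})"
  define B where "B = insert b ((\<lambda>i. [i]) ` {1..m})"
  have c: "c \<in> {Suc m..n}" using assms by (auto simp: c_def)
  have setb: "set b = {Suc m..n}" and distb: "distinct b" using c by (auto simp: b_def)
  have bne: "b \<noteq> []" by (simp add: b_def)
  have "block_weight b = card {Suc m..<c}"
  proof -
    have "{x \<in> {Suc m..n}. x < c} = {Suc m..<c}" using c by auto
    then show ?thesis unfolding block_weight_def setb by (simp add: b_def)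
  qed
  then have wb: "block_weight b = l" by (simp add: c_def)
  have nb: "b \<notin> (\<lambda>i. [i]) ` {1..m}"
  proof
    assume "b \<in> (\<lambda>i. [i]) ` {1..m}"
    then obtain i where "i \<le> m" "b = [i]" by auto
    with c show False by (simp add: b_def)
  qed
  have w1: "block_weight [i] = 0" for i by (simp add: block_weight_def)
  have "B \<in> ordered_partitions {1..n}"
    unfolding ordered_partitions_iff
  proof (intro conjI ballI impI)
    have "(\<Union>d\<in>B. set d) = set b \<union> (\<Union>i\<in>{1..m}. set [i])" unfolding B_def by simp
    also have "\<dots> = {Suc m..n} \<union> {1..m}" unfolding setb by simp
    also have "\<dots> = {1..n}" using assms by auto
    finally show "(\<Union>d\<in>B. set d) = {1..n}" .
    show "set d \<inter> set d' = {}" if "d \<in> B" "d' \<in> B" "d \<noteq> d'" for d d'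
      using that setb by (auto simp: B_def)
    show "distinct d" "d \<noteq> []" if "d \<in> B" for d
      using that distb bne by (auto simp: B_def)
  qed
  moreover have "card B = Suc m"
    using nb by (simp add: B_def card_image inj_on_def)
  moreover have "(\<Sum>b\<in>B. block_weight b) = l"
    using nb by (simp add: B_def wb w1 sum.reindex inj_on_def)
  ultimately have "B \<in> {B. ordered_block_partition n B \<and> card B = Suc m \<and> (\<Sum>b\<in>B. block_weight b) = l}"
    unfolding ordered_partitions_atLeastAtMost by simp
  moreover have "finite {B. ordered_block_partition n B \<and> card B = Suc m \<and> (\<Sum>b\<in>B. block_weight b) = l}"
    using finite_ordered_partitions[of "{1..n}"]
    by (simp add: ordered_partitions_atLeastAtMost[symmetric])
  ultimately show ?thesis unfolding weighted_lah_def by (auto simp: card_gt_0_iff)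
qed

section \<open>Eulerian numbers by inserting the largest entry\<close>

fun list_descents :: "nat list \<Rightarrow> nat" where
  "list_descents (a # b # xs) = (if a > b then 1 else 0) + list_descents (b # xs)"
| "list_descents _ = 0"

text \<open>
  The list has a fixed first entry $a$ that the insertion does not precede; this is the version of
  the insertion count that can be proved by induction, as a new first entry only adds the
  possible descent between the first two entries.
\<close>

lemma sum_list_descents_insert_tail:
  fixes x :: "'a::comm_ring_1"
  assumes "\<forall>a\<in>set (a # xs). a < M"
  shows "(\<Sum>i\<le>length xs. x ^ list_descents (a # take i xs @ M # drop i xs))
     = of_nat (Suc (list_descents (a # xs))) * x ^ list_descents (a # xs)
       + (of_nat (length xs) - of_nat (list_descents (a # xs))) * x ^ Suc (list_descents (a # xs))"
  using assms
proof (induction xs arbitrary: a)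
  case (Cons b xs)
  define d where "d = list_descents (b # xs)"
  have "(\<Sum>i\<le>length xs. x ^ list_descents (b # take i xs @ M # drop i xs))
     = of_nat (Suc d) * x ^ d + (of_nat (length xs) - of_nat d) * x ^ Suc d"
    using Cons.IH[of b] Cons.prems unfolding d_def by simp
  moreover have "(\<Sum>i\<le>length (b # xs). x ^ list_descents (a # take i (b # xs) @ M # drop i (b # xs)))
     = x ^ Suc d + x ^ (if a > b then 1 else 0) *
         (\<Sum>i\<le>length xs. x ^ list_descents (b # take i xs @ M # drop i xs))"
    using Cons.prems by (simp add: sum.atMost_Suc_shift sum_distrib_left d_def del: sum.atMost_Suc)
  ultimately have total: "(\<Sum>i\<le>length (b # xs). x ^ list_descents (a # take i (b # xs) @ M # drop i (b # xs)))
     = x ^ Suc d + x ^ (if a > b then 1 else 0) *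
         (of_nat (Suc d) * x ^ d + (of_nat (length xs) - of_nat d) * x ^ Suc d)"
    by (simp only:)
  show ?case
    unfolding total by (simp add: d_def[symmetric] algebra_simps)
qed simp

text \<open>
  In a list of length $n$, inserting an entry larger than all others at the end or
  inside one of the $d$ descents keeps the number of descents; each of the other $n - d$ positions creates one more.
\<close>

lemma sum_list_descents_insert:
  fixes x :: "'a::comm_ring_1"
  assumes "\<forall>a\<in>set xs. a < M"
  shows "(\<Sum>i\<le>length xs. x ^ list_descents (take i xs @ M # drop i xs))
     = of_nat (Suc (list_descents xs)) * x ^ list_descents xs
       + (of_nat (length xs) - of_nat (list_descents xs)) * x ^ Suc (list_descents xs)"
proof (cases xs)
  case (Cons a ys)
  then show ?thesis
    using sum_list_descents_insert_tail[of a ys M x] assms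
    by (simp add: sum.atMost_Suc_shift algebra_simps del: sum.atMost_Suc)
qed simp

lemma bij_betw_insert_permutation:
  assumes "M \<notin> A" "finite A"
  shows "bij_betw (\<lambda>(xs, i). take i xs @ M # drop i xs)
     (permutations_of_set A \<times> {..card A}) (permutations_of_set (insert M A))"
proof (rule bij_betwI)
  let ?g = "\<lambda>ys. (remove1 M ys, length (takeWhile (\<lambda>a. a \<noteq> M) ys))"
  have split: "\<exists>us vs. ys = us @ M # vs \<and> M \<notin> set us \<and> M \<notin> set vs \<and> us @ vs \<in> permutations_of_set A"
    if "ys \<in> permutations_of_set (insert M A)" for ys
  proof -
    have ys: "distinct ys" "set ys = insert M A" using that by (auto simp: permutations_of_set_def)
    then obtain us vs where "ys = us @ M # vs" using split_list[of M ys] by auto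
    with ys assms(1) have "M \<notin> set us" "M \<notin> set vs" "distinct (us @ vs)" "set us \<union> set vs = A"
      by auto
    with \<open>ys = us @ M # vs\<close> show ?thesis
      by (intro exI[of _ us] exI[of _ vs]) (simp add: permutations_of_set_def)
  qed
  show "(\<lambda>(xs, i). take i xs @ M # drop i xs) \<in> permutations_of_set A \<times> {..card A} \<rightarrow> permutations_of_set (insert M A)"
  proof (clarify)
    fix xs i assume "xs \<in> permutations_of_set A"
    then have xs: "set xs = A" "distinct xs" by (auto simp: permutations_of_set_def)
    have "set (take i xs) \<union> set (drop i xs) = A"
      by (metis append_take_drop_id set_append xs(1))
    moreover have "distinct (take i xs @ drop i xs)" using xs by simp
    ultimately show "take i xs @ M # drop i xs \<in> permutations_of_set (insert M A)"
      unfolding distinct_append using assms by (auto simp: permutations_of_set_def)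
  qed
  show "?g \<in> permutations_of_set (insert M A) \<rightarrow> permutations_of_set A \<times> {..card A}"
  proof
    fix ys assume "ys \<in> permutations_of_set (insert M A)"
    from split[OF this] obtain us vs where *: "ys = us @ M # vs" "M \<notin> set us" "M \<notin> set vs"
      "us @ vs \<in> permutations_of_set A" by auto
    from *(4) have "length us + length vs = card A"
      by (metis length_append length_finite_permutations_of_set)
    moreover have "takeWhile (\<lambda>a. a \<noteq> M) (us @ M # vs) = us"
      using * by (subst takeWhile_append2) auto
    ultimately show "?g ys \<in> permutations_of_set A \<times> {..card A}"
      using * by (simp add: remove1_append)
  qed
  show "?g (case p of (xs, i) \<Rightarrow> take i xs @ M # drop i xs) = p"
    if "p \<in> permutations_of_set A \<times> {..card A}" for p
  proof -
    obtain xs i where p: "p = (xs, i)" by (cases p)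
    with that have xs: "set xs = A" "i \<le> length xs" 
      by (auto simp: permutations_of_set_def distinct_card)
    have "M \<notin> set (take i xs)" using xs assms set_take_subset by fast
    moreover have "takeWhile (\<lambda>a. a \<noteq> M) (take i xs @ M # drop i xs) = take i xs"
      using \<open>M \<notin> set (take i xs)\<close> by (subst takeWhile_append2) auto
    ultimately show ?thesis using xs by (simp add: p remove1_append)
  qed
  show "(case ?g ys of (xs, i) \<Rightarrow> take i xs @ M # drop i xs) = ys"
    if "ys \<in> permutations_of_set (insert M A)" for ys
  proof -
    from split[OF that] obtain us vs where *: "ys = us @ M # vs" "M \<notin> set us" "M \<notin> set vs" by auto
    have "takeWhile (\<lambda>a. a \<noteq> M) (us @ M # vs) = us"
      using * by (subst takeWhile_append2) auto
    with * show ?thesis by (simp add: remove1_append)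
  qed
qed

lemma list_descents_snoc:
  "list_descents (xs @ [a, b]) = list_descents (xs @ [a]) + (if a > b then 1 else 0)"
  by (induction xs rule: list_descents.induct) auto

lemma list_descents_map: "list_descents (map p [1..<Suc m]) = card (descents m p)"
proof (induction m)
  case (Suc m)
  show ?case
  proof (cases m)
    case (Suc l)
    have "map p [1..<Suc (Suc m)] = map p [1..<m] @ [p m, p (Suc m)]"
      using Suc by simp
    moreover have "map p [1..<Suc m] = map p [1..<m] @ [p m]"
      using Suc by simp
    moreover have "descents (Suc m) p = descents m p \<union> (if p m > p (Suc m) then {m} else {})"
      using Suc by (auto simp: descents_def less_Suc_eq)
    moreover have "finite (descents m p)" "m \<notin> descents m p" by (auto simp: descents_def)
    ultimately show ?thesis using Suc.IH by (simp only: list_descents_snoc) simp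
  qed (simp add: descents_def)
qed (simp add: descents_def)

lemma bij_betw_permutes_list:
  "bij_betw (\<lambda>p. map p [1..<Suc m]) {p. p permutes {1..m}} (permutations_of_set {1..m})"
proof -
  let ?f = "\<lambda>p::nat\<Rightarrow>nat. map p [1..<Suc m]" and ?P = "{p. p permutes {1..m}}"
  have inj: "inj_on ?f ?P"
  proof (rule inj_onI, rule ext)
    fix p q i assume pq: "p \<in> ?P" "q \<in> ?P" "?f p = ?f q"
    have "\<forall>i\<in>set [1..<Suc m]. p i = q i" using pq(3) unfolding map_eq_conv .
    moreover have "set [1..<Suc m] = {1..m}" by auto
    ultimately have "p i = q i" if "i \<in> {1..m}" using that by blast
    moreover have "p i = q i" if "i \<notin> {1..m}"
      using that pq(1,2) permutes_not_in[of p "{1..m}" i] permutes_not_in[of q "{1..m}" i] by simp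
    ultimately show "p i = q i" by blast
  qed
  have sub: "?f ` ?P \<subseteq> permutations_of_set {1..m}"
  proof (clarify)
    fix p assume p: "p permutes {1..m}"
    have "set (?f p) = p ` {1..m}" by auto
    also have "\<dots> = {1..m}" using permutes_image[OF p] .
    finally show "?f p \<in> permutations_of_set {1..m}"
      using permutes_inj_on[OF p] by (auto simp: permutations_of_set_def distinct_map simp del: upt_Suc)
  qed
  have "card (?f ` ?P) = card (permutations_of_set {1..m})"
    using card_image[OF inj] card_permutations[of "{1..m}" m] by simp
  with sub have "?f ` ?P = permutations_of_set {1..m}"
    by (intro card_subset_eq) auto
  with inj show ?thesis by (simp add: bij_betw_def)
qed

definition eulerian_fps :: "nat \<Rightarrow> 'a::field_char_0 fps" where
  "eulerian_fps m = Abs_fps (\<lambda>j. of_nat (eulerian m j))"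

lemma eulerian_fps_eq_sum:
  "eulerian_fps m = (\<Sum>xs\<in>permutations_of_set {1..m}. fps_X ^ list_descents xs)"
proof (rule fps_ext)
  fix j
  have "eulerian m j = card ((\<lambda>p. map p [1..<Suc m]) ` {p. p permutes {1..m} \<and> card (descents m p) = j})"
    unfolding eulerian_def
    by (intro card_image[symmetric] inj_on_subset[OF bij_betw_imp_inj_on[OF bij_betw_permutes_list[of m]]]) auto
  also have "(\<lambda>p. map p [1..<Suc m]) ` {p. p permutes {1..m} \<and> card (descents m p) = j}
     = {xs \<in> permutations_of_set {1..m}. list_descents xs = j}"
    unfolding bij_betw_imp_surj_on[OF bij_betw_permutes_list[of m], symmetric] list_descents_map[symmetric] by auto
  finally have card: "eulerian m j = card {xs \<in> permutations_of_set {1..m}. list_descents xs = j}" .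
  have "(\<Sum>xs\<in>permutations_of_set {1..m}. fps_X ^ list_descents xs :: 'a fps) $ j
      = (\<Sum>xs\<in>permutations_of_set {1..m}. if list_descents xs = j then 1 else 0)"
    by (auto simp: fps_sum_nth fps_X_power_iff intro!: sum.cong)
  also have "\<dots> = of_nat (card {xs \<in> permutations_of_set {1..m}. list_descents xs = j})"
    by (subst sum.inter_filter[symmetric]) simp_all
  finally show "eulerian_fps m $ j = (\<Sum>xs\<in>permutations_of_set {1..m}. fps_X ^ list_descents xs :: 'a fps) $ j"
    by (simp add: eulerian_fps_def card)
qed

text \<open>
  The insertion count is linear in the monomials: on $X^d$ the operator
  $F \mapsto (1 - X)(XF)' + (m+1) X F$ has the value $(d+1) X^d + (m-d) X^{d+1}$.
\<close>

lemma eulerian_fps_Suc: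
  "eulerian_fps (Suc m) = (1 - fps_X) * fps_deriv (fps_X * eulerian_fps m)
     + of_nat (Suc m) * fps_X * eulerian_fps m"
proof -
  let ?D = "\<lambda>F :: 'a fps. (1 - fps_X) * fps_deriv (fps_X * F) + of_nat (Suc m) * fps_X * F"
  have eq: "{1..Suc m} = insert (Suc m) {1..m}" by auto
  have "eulerian_fps (Suc m) = (\<Sum>(xs, i)\<in>permutations_of_set {1..m} \<times> {..m}.
      fps_X ^ list_descents (take i xs @ Suc m # drop i xs) :: 'a fps)"
    unfolding eulerian_fps_eq_sum eq
    using sum.reindex_bij_betw[OF bij_betw_insert_permutation[of "Suc m" "{1..m}"],
        of "\<lambda>xs. fps_X ^ list_descents xs :: 'a fps"] by (simp add: case_prod_unfold)
  also have "\<dots> = (\<Sum>xs\<in>permutations_of_set {1..m}. \<Sum>i\<le>m.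
      fps_X ^ list_descents (take i xs @ Suc m # drop i xs))"
    by (simp add: sum.cartesian_product)
  also have "\<dots> = (\<Sum>xs\<in>permutations_of_set {1..m}. ?D (fps_X ^ list_descents xs))"
  proof (rule sum.cong)
    fix xs assume "xs \<in> permutations_of_set {1..m}"
    then have xs: "set xs = {1..m}" "length xs = m"
      by (auto simp: permutations_of_set_def distinct_card[symmetric])
    have "fps_deriv (fps_X * fps_X ^ d) = (of_nat (Suc d) * fps_X ^ d :: 'a fps)" for d
      using fps_deriv_power'[of fps_X "Suc d"] by simp
    then show "(\<Sum>i\<le>m. fps_X ^ list_descents (take i xs @ Suc m # drop i xs)) = ?D (fps_X ^ list_descents xs)"
      using sum_list_descents_insert[of xs "Suc m" "fps_X :: 'a fps"] xs
      by (simp add: algebra_simps)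
  qed simp
  also have "\<dots> = ?D (eulerian_fps m)"
    unfolding eulerian_fps_eq_sum
    by (simp only: sum.distrib sum_distrib_left[symmetric] fps_deriv_sum[symmetric])
  finally show ?thesis .
qed

lemma eulerian_rec:
  "of_nat (eulerian (Suc m) j) = (of_nat (Suc j) * of_nat (eulerian m j)
     + (if j = 0 then 0 else (of_nat (Suc m) - of_nat j) * of_nat (eulerian m (j - 1))) :: 'a::field_char_0)"
proof -
  have "eulerian_fps (Suc m) $ j = (fps_deriv (fps_X * eulerian_fps m) - fps_X * fps_deriv (fps_X * eulerian_fps m)
     + fps_const (of_nat (Suc m)) * (fps_X * eulerian_fps m) :: 'a fps) $ j"
    unfolding eulerian_fps_Suc fps_of_nat by (simp add: algebra_simps)
  moreover have "(fps_X * fps_deriv F) $ j = of_nat j * F $ j" for F :: "'a fps"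
    by (cases j) simp_all
  ultimately have "eulerian_fps (Suc m) $ j = (of_nat (Suc j) * eulerian_fps m $ j
     - of_nat j * (fps_X * eulerian_fps m) $ j + of_nat (Suc m) * (fps_X * eulerian_fps m) $ j :: 'a)"
    by (simp only: fps_add_nth fps_sub_nth fps_mult_left_const_nth fps_deriv_nth) simp
  then show ?thesis
    by (cases j) (simp_all add: eulerian_fps_def algebra_simps)
qed

text \<open>
  The operator $P \mapsto (XP)'$ raises the exponent of $(i+1)^m$ by one. Carrying it across
  the factor $(1 - X)^{m+1}$ by the product rule gives the operator of the Eulerian recursion.
\<close>

lemma carlitz_identity:
  "(1 - fps_X) ^ Suc m * Abs_fps (\<lambda>i. of_nat (Suc i) ^ m) = (eulerian_fps m :: 'a::field_char_0 fps)"
proof (induction m)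
  case 0
  have "eulerian 0 j = (if j = 0 then 1 else 0)" for j
    by (auto simp: eulerian_def descents_def)
  then have "eulerian_fps 0 = (1 :: 'a fps)" by (auto simp: eulerian_fps_def fps_eq_iff)
  moreover have "(1 - fps_X) * Abs_fps (\<lambda>_. 1) = (1 :: 'a fps)"
    by (simp add: fps_eq_iff left_diff_distrib)
  ultimately show ?case by simp
next
  case (Suc m)
  define P where "P = Abs_fps (\<lambda>i. of_nat (Suc i) ^ m :: 'a)"
  have A: "eulerian_fps m = (1 - fps_X) ^ Suc m * P" using Suc.IH by (simp add: P_def)
  have B: "Abs_fps (\<lambda>i. of_nat (Suc i) ^ Suc m :: 'a) = fps_deriv (fps_X * P)"
    by (simp add: fps_eq_iff P_def distrib_right)
  have D: "fps_deriv (fps_X * eulerian_fps m)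
     = (1 - fps_X) ^ Suc m * fps_deriv (fps_X * P) - of_nat (Suc m) * (1 - fps_X) ^ m * fps_X * P"
  proof -
    have dU: "fps_deriv ((1 - fps_X) ^ Suc m) = - (of_nat (Suc m) * (1 - fps_X :: 'a fps) ^ m)"
      by (subst fps_deriv_power') (simp add: algebra_simps)
    have "fps_X * eulerian_fps m = (1 - fps_X) ^ Suc m * (fps_X * P)"
      unfolding A by (simp only: mult_ac)
    then have "fps_deriv (fps_X * eulerian_fps m)
       = (1 - fps_X) ^ Suc m * fps_deriv (fps_X * P) + fps_deriv ((1 - fps_X) ^ Suc m) * (fps_X * P)"
      by (simp only: fps_deriv_mult[of "(1 - fps_X) ^ Suc m"])
    then show ?thesis unfolding dU
      by (simp only: mult_minus_left add_uminus_conv_diff mult.assoc)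
  qed
  have ring: "a * (a * u) * d = a * (a * u * d - c * u * x * p) + c * x * (a * u * p)"
    for a u d c x p :: "'a fps"
    by (simp add: algebra_simps)
  show ?case
    unfolding eulerian_fps_Suc B D unfolding A power_Suc by (rule ring)
qed

lemma eulerian_pos: "j < m \<Longrightarrow> 0 < eulerian m j"
proof (induction m arbitrary: j)
  case (Suc m)
  have rec: "real (eulerian (Suc m) j) = real (Suc j) * real (eulerian m j)
     + (if j = 0 then 0 else (real (Suc m) - real j) * real (eulerian m (j - 1)))"
    by (rule eulerian_rec)
  have "0 < eulerian 0 0" by (simp add: eulerian_def descents_def)
  with Suc have pos: "j < m \<or> j = 0 \<Longrightarrow> 0 < eulerian m j" "j \<noteq> 0 \<Longrightarrow> 0 < eulerian m (j - 1)"
    by (cases m; force)+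
  have "0 < real (eulerian (Suc m) j)"
    unfolding rec using pos Suc.prems
    by (cases "j = 0") (auto intro!: add_nonneg_pos mult_pos_pos)
  then show ?case by simp
qed simp

section \<open>Counting functions with bounded values and prescribed sum\<close>

lemma neg_binomial_fps_of_nat: "(1 - fps_X) ^ n * neg_binomial_fps 1 (of_nat n) = (1 :: 'a::field_char_0 fps)"
proof (cases "n = 0")
  case True
  then show ?thesis
    by (auto simp: neg_binomial_fps_def fps_eq_iff pochhammer_0_left)
next
  case False
  have "inverse ((1 - fps_X) ^ n) = Abs_fps (\<lambda>k. of_nat ((n + k - 1) choose k) :: 'a)"
    using one_minus_const_fps_X_neg_power'[of n "1::'a"] False by simp
  also have "\<dots> = neg_binomial_fps 1 (of_nat n)"
    using False by (simp add: fps_eq_iff neg_binomial_fps_def binomial_gbinomial gbinomial_pochhammer'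
       of_nat_diff)
  finally show ?thesis
    by (metis inverse_mult_eq_1' fps_nth_power_0 fps_sub_nth fps_one_nth fps_X_nth power_one one_neq_zero diff_zero zero_neq_one)
qed

text \<open>
  Expanding the product of $|I|$ copies of $1 + X + \dots + X^t$ chooses an exponent for each
  index, which is the function counted.
\<close>

lemma card_bounded_functions:
  assumes "finite I"
  shows "of_nat (card {f \<in> PiE I (\<lambda>_. {..t}). sum f I = s}) = ((\<Sum>a\<le>t. fps_X ^ a) ^ card I :: 'a::field_char_0 fps) $ s"
proof -
  have fin: "finite (PiE I (\<lambda>_. {..t::nat}))" using assms by (simp add: finite_PiE)
  have "(\<Sum>a\<le>t. fps_X ^ a :: 'a fps) ^ card I = (\<Prod>i\<in>I. \<Sum>a\<le>t. fps_X ^ a)"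
    by simp
  also have "\<dots> = (\<Sum>f\<in>PiE I (\<lambda>_. {..t}). \<Prod>i\<in>I. fps_X ^ f i)"
    using assms by (intro prod_sum_PiE) auto
  also have "\<dots> = (\<Sum>f\<in>PiE I (\<lambda>_. {..t}). fps_X ^ sum f I)"
    by (simp add: power_sum)
  also have "\<dots> $ s = (\<Sum>f\<in>PiE I (\<lambda>_. {..t}). if sum f I = s then 1 else 0)"
    by (auto simp: fps_sum_nth fps_X_power_iff intro!: sum.cong)
  also have "\<dots> = of_nat (card {f \<in> PiE I (\<lambda>_. {..t}). sum f I = s})"
    using fin by (subst sum.inter_filter[symmetric]) simp_all
  finally show ?thesis by simp
qed

text \<open>
  The coefficient of $X^{kt}$ in $(1 - X^{t+1})^n (1 - X)^{-n}$ is a sum over $j$ that stops as soon as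
  $j(t+1) > kt$, a range that depends on $t$. It becomes a polynomial in $t$ because the range can be
  replaced by $j < k$: for such $j$ the argument $kt - j(t+1)$ is larger than $-n$, and if it is
  negative then one of the $n - 1$ consecutive factors is zero.
\<close>

lemma card_bounded_functions_eq:
  assumes I: "finite I" "card I = n" and k: "1 \<le> k" "k \<le> n"
  shows "of_nat (card {f \<in> PiE I (\<lambda>_. {..t}). sum f I = k * t})
     = (1 / fact (n - 1) * (\<Sum>j<k. (- 1) ^ j * of_nat (n choose j) *
          poly (shifted_rising n j) (of_nat (k - j) * of_nat t)) :: 'a::field_char_0)"
proof -
  let ?G = "neg_binomial_fps 1 (of_nat n) :: 'a fps"
  have n: "1 \<le> n" using k by simp
  have "(1 - fps_X :: 'a fps) * (\<Sum>a\<le>t. fps_X ^ a) = 1 - fps_X ^ Suc t"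
    using one_diff_power_eq[of "fps_X :: 'a fps" "Suc t"] by (simp only: lessThan_Suc_atMost)
  then have "(1 - fps_X ^ Suc t) ^ n * ?G = (\<Sum>a\<le>t. fps_X ^ a) ^ n * ((1 - fps_X) ^ n * ?G)"
    by (simp only: power_mult_distrib[symmetric] mult.assoc[symmetric] mult.commute[of "1 - fps_X"])
  then have "(\<Sum>a\<le>t. fps_X ^ a) ^ n = (1 - fps_X ^ Suc t) ^ n * ?G"
    unfolding neg_binomial_fps_of_nat by simp
  also have "(1 - fps_X ^ Suc t :: 'a fps) ^ n = (\<Sum>j\<le>n. fps_const ((- 1) ^ j * of_nat (n choose j)) * fps_X ^ (j * Suc t))"
  proof -
    have "(1 - fps_X ^ Suc t :: 'a fps) ^ n = (- (fps_X ^ Suc t) + 1) ^ n" by simp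
    also have "\<dots> = (\<Sum>j\<le>n. of_nat (n choose j) * (- (fps_X ^ Suc t)) ^ j)"
      unfolding binomial_ring by simp
    also have "\<dots> = (\<Sum>j\<le>n. fps_const ((- 1) ^ j * of_nat (n choose j)) * fps_X ^ (j * Suc t))"
    proof (rule sum.cong)
      fix j
      have "(- (fps_X ^ Suc t)) ^ j = (- 1) ^ j * (fps_X ^ (j * Suc t) :: 'a fps)"
        unfolding power_minus[of "fps_X ^ Suc t"] power_mult[symmetric] mult.commute[of "Suc t" j] ..
      moreover have "fps_const ((- 1) ^ j * of_nat (n choose j)) = (- 1) ^ j * (of_nat (n choose j) :: 'a fps)"
        by (simp flip: fps_const_mult fps_const_power fps_const_neg add: fps_of_nat)
      ultimately show "of_nat (n choose j) * (- (fps_X ^ Suc t)) ^ j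
          = fps_const ((- 1) ^ j * of_nat (n choose j)) * (fps_X ^ (j * Suc t) :: 'a fps)"
        by (simp only: mult_ac)
    qed simp
    finally show ?thesis .
  qed
  finally have "((\<Sum>a\<le>t. fps_X ^ a) ^ n) $ (k * t)
     = (\<Sum>j\<le>n. (- 1) ^ j * of_nat (n choose j) * (fps_X ^ (j * Suc t) * ?G) $ (k * t))"
    by (simp add: sum_distrib_right fps_sum_nth mult.assoc)
  also have "\<dots> = (\<Sum>j\<le>n. if j < k then (- 1) ^ j * of_nat (n choose j) *
          (poly (shifted_rising n j) (of_nat (k - j) * of_nat t) / fact (n - 1)) else 0)"
  proof (rule sum.cong)
    fix j
    have "(fps_X ^ (j * Suc t) * ?G) $ (k * t)
        = (if j < k then poly (shifted_rising n j) (of_nat (k - j) * of_nat t) / fact (n - 1) else 0)"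
    proof (cases "j < k")
      case False
      then have "k * t \<le> j * t" "0 < j" using k by auto
      \<comment> \<open>$0 < j$ is essential if $t = 0$\<close>
      then have "k * t < j * Suc t" unfolding mult_Suc_right by linarith
      with False show ?thesis by (simp add: fps_X_power_mult_nth)
    next
      case True
      have kj: "of_nat (k - j) * of_nat t = (of_nat (k * t) - of_nat (j * t) :: 'a)"
        using True by (simp add: of_nat_diff algebra_simps)
      show ?thesis
      proof (cases "k * t < j * Suc t")
        case lt: True
        \<comment> \<open>the factors start at $-a$ and there are $n - 1 > a$ of them, so one is $0$\<close>
        define a where "a = j * Suc t - k * t - 1"
        have "k * t + a + 1 = j * t + j" using lt by (simp add: a_def)
        then have a': "of_nat (k * t) + of_nat a + 1 = (of_nat (j * t) + of_nat j :: 'a)"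
          by (metis of_nat_1 of_nat_add)
        have "of_nat (k * t) - of_nat (j * t) + 1 - of_nat j = - (of_nat a :: 'a)"
          using a' by algebra
        moreover have "j * t \<le> k * t" using True by simp
        then have "a < n - 1" using lt True k unfolding a_def mult_Suc_right by linarith
        ultimately have "poly (shifted_rising n j) (of_nat (k - j) * of_nat t) = (0 :: 'a)"
          unfolding poly_shifted_rising kj by (simp only: pochhammer_of_nat_eq_0_lemma)
        with lt True show ?thesis by (simp add: fps_X_power_mult_nth)
      next
        case False
        \<comment> \<open>both sides are the binomial coefficient of $r + n - 1$ over $n - 1$\<close>
        define r where "r = k * t - j * Suc t"
        have "k * t = j * t + j + r" using False by (simp add: r_def)
        then have arg: "of_nat (k * t) - of_nat (j * t) + 1 - of_nat j = (1 + of_nat r :: 'a)"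
          by (simp only: of_nat_add) simp
        moreover have "pochhammer (of_nat n) r / fact r = (pochhammer (1 + of_nat r) (n - 1) / fact (n - 1) :: 'a)"
        proof -
          have "pochhammer (1 :: 'a) ((n - 1) + r) = pochhammer 1 (r + (n - 1))" by (simp add: add.commute)
          then have "fact (n - 1) * pochhammer (of_nat n) r = (fact r * pochhammer (1 + of_nat r) (n - 1) :: 'a)"
            unfolding pochhammer_product' using n by (simp add: pochhammer_fact[symmetric] of_nat_diff)
          then show ?thesis by (simp add: divide_simps mult_ac)
        qed
        moreover have "(fps_X ^ (j * Suc t) * ?G) $ (k * t) = pochhammer (of_nat n) r / fact r"
          using False by (simp only: fps_X_power_mult_nth neg_binomial_fps_def r_def fps_nth_Abs_fps) simp
        ultimately show ?thesis
          using True unfolding poly_shifted_rising kj arg by simp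
      qed
    qed
    then show "(- 1) ^ j * of_nat (n choose j) * (fps_X ^ (j * Suc t) * ?G) $ (k * t)
       = (if j < k then (- 1) ^ j * of_nat (n choose j) *
          (poly (shifted_rising n j) (of_nat (k - j) * of_nat t) / fact (n - 1)) else 0)" by simp
  qed simp
  also have "\<dots> = (\<Sum>j | j \<in> {..n} \<and> j < k. (- 1) ^ j * of_nat (n choose j) *
          (poly (shifted_rising n j) (of_nat (k - j) * of_nat t) / fact (n - 1)))"
    by (simp only: sum.inter_filter finite_atMost)
  also have "{j. j \<in> {..n} \<and> j < k} = {..<k}" using k by auto
  finally show ?thesis
    using card_bounded_functions[OF I(1), of t "k * t", where 'a = 'a] I(2)
    by (simp add: sum_divide_distrib mult_ac)
qed

text \<open>
  The left side is a coefficient of a product of two series: the first is $(1-X)^{m+1}$ times the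
  series of weighted Lah numbers, and the second is $\sum_i (i+1)^m X^i$. The power of $1 - X$ moves
  from the first factor to the second, where it produces the Eulerian numbers.
\<close>

lemma shifted_rising_eulerian_convolution:
  assumes "1 \<le> n" "1 \<le> k"
  shows "(\<Sum>j<k. (- 1) ^ j * of_nat (n choose j) * of_nat (k - j) ^ m * coeff (shifted_rising n j) m)
     = (\<Sum>l = 0..k - 1. of_nat (weighted_lah l n (m + 1)) * of_nat (eulerian m (k - l - 1)) :: 'a::field_char_0)"
proof -
  define C where "C = Abs_fps (\<lambda>j. (- 1) ^ j * of_nat (n choose j) * coeff (shifted_rising n j) m :: 'a)"
  define W where "W = Abs_fps (\<lambda>l. of_nat (weighted_lah l n (Suc m)) :: 'a)"
  define P where "P = Abs_fps (\<lambda>i. of_nat (Suc i) ^ m :: 'a)"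
  have "C * P = W * ((1 - fps_X) ^ Suc m * P)"
    using lah_fps_identity[OF assms(1), of m, where 'a = 'a]
    unfolding C_def[symmetric] W_def[symmetric] by (metis mult.assoc mult.commute)
  also have "\<dots> = W * eulerian_fps m" unfolding P_def carlitz_identity ..
  finally have "(C * P) $ (k - 1) = (W * eulerian_fps m) $ (k - 1)" by simp
  moreover have "(C * P) $ (k - 1) = (\<Sum>j<k. (- 1) ^ j * of_nat (n choose j) * of_nat (k - j) ^ m * coeff (shifted_rising n j) m)"
  proof -
    have eq: "{0..k - 1} = {..<k}" using assms(2) by auto
    show ?thesis
      unfolding fps_mult_nth eq
    proof (rule sum.cong)
      fix j assume "j \<in> {..<k}"
      then have "Suc (k - 1 - j) = k - j" by auto
      then have "P $ (k - 1 - j) = of_nat (k - j) ^ m" unfolding P_def fps_nth_Abs_fps by simp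
      then show "C $ j * P $ (k - 1 - j)
          = (- 1) ^ j * of_nat (n choose j) * of_nat (k - j) ^ m * coeff (shifted_rising n j) m"
        by (simp add: C_def)
    qed simp
  qed
  ultimately show ?thesis
    by (simp add: fps_mult_nth W_def eulerian_fps_def)
qed

unbundle no fps_syntax
unbundle vec_syntax

section \<open>The Ehrhart polynomial and its coefficients\<close>

text \<open>
  The bound on $k$ is there for $t = 0$: the dilation by $0$ has the origin as its lattice point
  precisely because the hypersimplex is not empty.
\<close>

lemma card_lattice_points_hypersimplex:
  assumes "k \<le> CARD('n::finite)"
  shows "card (lattice_points ((\<lambda>x. real t *\<^sub>R x) ` (hypersimplex k :: (real ^ 'n) set)))
     = card {f \<in> PiE (UNIV :: 'n set) (\<lambda>_. {..t}). sum f UNIV = k * t}"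
proof -
  let ?F = "{f \<in> PiE (UNIV :: 'n set) (\<lambda>_. {..t}). sum f UNIV = k * t}"
  let ?v = "\<lambda>f :: 'n \<Rightarrow> nat. (\<chi> i. real (f i))"
  have inj: "inj_on ?v ?F"
    by (auto simp: inj_on_def vec_eq_iff)
  have img: "?v ` ?F = lattice_points ((\<lambda>x. real t *\<^sub>R x) ` (hypersimplex k :: (real ^ 'n) set))"
  proof (intro equalityI subsetI)
    fix x assume "x \<in> ?v ` ?F"
    then obtain f where f: "x = ?v f" "\<And>i. f i \<le> t" "sum f UNIV = k * t" by auto
    have "x \<in> (\<lambda>x. real t *\<^sub>R x) ` hypersimplex k"
    proof (cases "t = 0")
      case True
      obtain A :: "'n set" where A: "card A = k" using assms obtain_subset_with_card_n[of k UNIV] by auto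
      have "(\<chi> i. if i \<in> A then 1 else 0) \<in> (hypersimplex k :: (real ^ 'n) set)"
        using A by (simp add: hypersimplex_def sum.If_cases)
      moreover have "x = real t *\<^sub>R (\<chi> i. if i \<in> A then 1 else 0)"
        using True f(1,2) by (simp add: vec_eq_iff)
      ultimately show ?thesis by blast
    next
      case False
      have "real (sum f UNIV) = real k * real t" using f(3) by simp
      then have "(\<Sum>i\<in>UNIV. real (f i) / real t) = real k"
        using False by (simp flip: sum_divide_distrib)
      then have "(\<chi> i. real (f i) / real t) \<in> hypersimplex k"
        using f(2) False by (simp add: hypersimplex_def)
      moreover have "x = real t *\<^sub>R (\<chi> i. real (f i) / real t)"
        using f(1) False by (simp add: vec_eq_iff)
      ultimately show ?thesis by blast
    qed
    then show "x \<in> lattice_points ((\<lambda>x. real t *\<^sub>R x) ` hypersimplex k)"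
      using f(1) by (simp add: lattice_points_def)
  next
    fix x :: "real ^ 'n" assume "x \<in> lattice_points ((\<lambda>x. real t *\<^sub>R x) ` hypersimplex k)"
    then have "x \<in> (\<lambda>x. real t *\<^sub>R x) ` hypersimplex k" and int: "\<And>i. x $ i \<in> \<int>"
      unfolding lattice_points_def by blast+
    then obtain y where "y \<in> hypersimplex k" "x = real t *\<^sub>R y" by blast
    then have y: "x = real t *\<^sub>R y" "\<And>i. 0 \<le> y $ i \<and> y $ i \<le> 1"
      "(\<Sum>i\<in>UNIV. y $ i) = real k"
      by (simp_all add: hypersimplex_def)
    have x: "x $ i = real t * y $ i" for i by (simp add: y(1))
    have "\<exists>a. x $ i = real a" for i
    proof -
      have "0 \<le> x $ i" unfolding x using y(2) by simp
      with int[of i] show ?thesis by (metis Ints_cases nat_0_le of_int_0_le_iff of_int_of_nat_eq)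
    qed
    then obtain f where f: "\<And>i. x $ i = real (f i)" by metis
    have "real (f i) \<le> real t" for i
      using y(2)[of i] mult_left_le[of "y $ i" "real t"] unfolding f[symmetric] x by simp
    moreover have "real (sum f UNIV) = real (k * t)"
      using y(3) unfolding of_nat_sum f[symmetric] x by (simp flip: sum_distrib_left)
    ultimately have "\<And>i. f i \<le> t" "sum f UNIV = k * t" by (simp_all only: of_nat_le_iff of_nat_eq_iff)
    then have "f \<in> ?F" by (simp add: PiE_UNIV_domain)
    moreover have "x = ?v f" by (simp add: vec_eq_iff f)
    ultimately show "x \<in> ?v ` ?F" by blast
  qed
  show ?thesis unfolding img[symmetric] by (rule card_image[OF inj])
qed

lemma poly_eqI_nat: "p = q" if "\<And>t::nat. poly p (of_nat t) = poly q (of_nat t)" for p q :: "'a::field_char_0 poly"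
proof (rule ccontr)
  assume "p \<noteq> q"
  then have "finite {x. poly (p - q) x = 0}" by (intro poly_roots_finite) simp
  moreover have "range (of_nat :: nat \<Rightarrow> 'a) \<subseteq> {x. poly (p - q) x = 0}" using that by auto
  ultimately have "finite (range (of_nat :: nat \<Rightarrow> 'a))" by (rule finite_subset[rotated])
  then show False using finite_imageD inj_of_nat infinite_UNIV_nat by blast
qed

lemma ehrhart_poly_hypersimplex:
  assumes "CARD('n::finite) = n" "1 \<le> k" "k \<le> n"
  shows "ehrhart_poly (hypersimplex k :: (real ^ 'n) set) = smult (1 / fact (n - 1))
     (\<Sum>j<k. smult ((- 1) ^ j * of_nat (n choose j)) (pcompose (shifted_rising n j) [:0, of_nat (k - j):]))"
    (is "_ = ?p")
proof -
  have p: "poly ?p (of_nat t) = of_nat (card (lattice_points ((\<lambda>x. real t *\<^sub>R x) ` (hypersimplex k :: (real ^ 'n) set))))" for t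
    using card_lattice_points_hypersimplex[of k t, where 'n = 'n] assms
      card_bounded_functions_eq[of "UNIV :: 'n set" n k t, where 'a = rat]
    by (simp add: poly_sum poly_pcompose mult_ac)
  show ?thesis
    unfolding ehrhart_poly_def
  proof (rule the_equality)
    show "\<forall>t::nat. poly ?p (of_nat t) = of_nat (card (lattice_points ((\<lambda>x. real t *\<^sub>R x) ` (hypersimplex k :: (real ^ 'n) set))))"
      using p by blast
    show "q = ?p" if "\<forall>t::nat. poly q (of_nat t) = of_nat (card (lattice_points ((\<lambda>x. real t *\<^sub>R x) ` (hypersimplex k :: (real ^ 'n) set))))" for q
      using that p by (intro poly_eqI_nat) simp
  qed
qed

theorem theorem4p3:
  fixes n k m :: nat
  assumes "CARD('n::finite) = n"
    and "1 \<le> k" and "k \<le> n"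
    and "m \<le> n - 1"
  shows "coeff (ehrhart_poly (hypersimplex k :: (real ^ 'n) set)) m =
           1 / fact (n - 1) *
             (\<Sum>l = 0..k - 1. of_nat (weighted_lah l n (m + 1)) * of_nat (eulerian m (k - l - 1)))
         \<and> (k < n \<or> m = 0 \<longrightarrow>
             coeff (ehrhart_poly (hypersimplex k :: (real ^ 'n) set)) m > 0)"
proof
  let ?S = "\<Sum>l = 0..k - 1. of_nat (weighted_lah l n (m + 1)) * of_nat (eulerian m (k - l - 1)) :: rat"
  have "coeff (ehrhart_poly (hypersimplex k :: (real ^ 'n) set)) m
      = 1 / fact (n - 1) * (\<Sum>j<k. (- 1) ^ j * of_nat (n choose j) * of_nat (k - j) ^ m * coeff (shifted_rising n j) m)"
    unfolding ehrhart_poly_hypersimplex[OF assms(1-3)]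
    by (simp add: coeff_sum coeff_pcompose_linear mult.assoc)
  also have "\<dots> = 1 / fact (n - 1) * ?S"
    using shifted_rising_eulerian_convolution[of n k m, where 'a = rat] assms(2,3) by simp
  finally show eq: "coeff (ehrhart_poly (hypersimplex k :: (real ^ 'n) set)) m = 1 / fact (n - 1) * ?S" .
  show "k < n \<or> m = 0 \<longrightarrow> coeff (ehrhart_poly (hypersimplex k :: (real ^ 'n) set)) m > 0"
  proof
    assume "k < n \<or> m = 0"
    \<comment> \<open>weight and descents must add up to $k - 1$; this is the smallest weight with fewer than $m$ descents, or all of $k - 1$ if $m = 0$\<close>
    define l where "l = (if m = 0 then k - 1 else k - m)"
    have l: "l \<in> {0..k - 1}" using assms(2) by (auto simp: l_def)
    have "l + m < n" using \<open>k < n \<or> m = 0\<close> assms(2-4) by (auto simp: l_def)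
    then have "0 < weighted_lah l n (m + 1)" using weighted_lah_pos by simp
    moreover have "0 < eulerian m (k - l - 1)"
    proof (cases "m = 0")
      case True
      then have "eulerian m (k - l - 1) = 1"
        using assms(2) by (simp add: l_def eulerian_def descents_def)
      then show ?thesis by simp
    next
      case False
      then show ?thesis using assms(2) by (intro eulerian_pos) (auto simp: l_def)
    qed
    ultimately have "0 < (of_nat (weighted_lah l n (m + 1)) * of_nat (eulerian m (k - l - 1)) :: rat)"
      by simp
    also have "\<dots> \<le> ?S"
      using l by (intro member_le_sum) auto
    finally show "coeff (ehrhart_poly (hypersimplex k :: (real ^ 'n) set)) m > 0"
      unfolding eq by simp
  qed
qed

end
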